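(* Let $L$ be a symmetric Latin square of order $n$ and let $\Gamma$ be its rrs-autotopism group. Then the number of isomorphism classes of symmetric Latin squares that are rrs-isotopic to $L$ equals \[\frac{1}{|\Gamma|}\sum_{(\alpha,\alpha,\beta)\in\Gamma}\psi(\alpha,\beta),\] where $\psi(\alpha,\beta)=\prod_{i=1}^k (n_i)!\,c_i^{n_i}$ if $\alpha$ and $\beta$ have the same cycle structure $c_1^{n_1}\cdots c_k^{n_k}$ (i.e. $n_i$ cycles of length $c_i$, with distinct $c_i$, fixed points counted as cycles of length 1), and $\psi(\alpha,\beta)=0$ otherwise.
   Context: A Latin square of order $n$ is a set of $n^2$ triples (row, column, symbol) over $\{1,\dots,n\}$, distinct triples agreeing in at most one coordinate; it is symmetric if it equals its transpose. An isotopism $(\alpha,\beta,\gamma)\in\mathcal{S}_n^3$ maps $(r,c,s)$ to $(r^\alpha,c^\beta,s^\gamma)$; it is an rrs-isotopism if $\alpha=\beta$ and an isomorphism if $\alpha=\beta=\gamma$. The rrs-autotopism group of $L$ is the group of rrs-isotopisms mapping $L$ to itself. *)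

theory Defs
  imports Complex_Main "HOL-Library.Multiset" "HOL-Combinatorics.Permutations"
    "HOL-Combinatorics.Orbits"
begin

type_synonym triple = "nat \<times> nat \<times> nat"

type_synonym isotopism = "(nat \<Rightarrow> nat) \<times> (nat \<Rightarrow> nat) \<times> (nat \<Rightarrow> nat)"

definition latin_square :: "nat \<Rightarrow> triple set \<Rightarrow> bool" where
  "latin_square n L \<longleftrightarrow>
     L \<subseteq> {1..n} \<times> {1..n} \<times> {1..n} \<and> card L = n ^ 2 \<and>
     (\<forall>(r, c, s) \<in> L. \<forall>(r', c', s') \<in> L. (r, c, s) \<noteq> (r', c', s') \<longrightarrow>
        \<not> (r = r' \<and> c = c') \<and> \<not> (r = r' \<and> s = s') \<and> \<not> (c = c' \<and> s = s'))"

definition latin_transpose :: "triple set \<Rightarrow> triple set" where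
  "latin_transpose L = (\<lambda>(r, c, s). (c, r, s)) ` L"

definition symmetric_latin_square :: "nat \<Rightarrow> triple set \<Rightarrow> bool" where
  "symmetric_latin_square n L \<longleftrightarrow> latin_square n L \<and> latin_transpose L = L"

definition isotopisms :: "nat \<Rightarrow> isotopism set" where
  "isotopisms n = {\<alpha>. \<alpha> permutes {1..n}} \<times> {\<beta>. \<beta> permutes {1..n}} \<times> {\<gamma>. \<gamma> permutes {1..n}}"

definition rrs_isotopisms :: "nat \<Rightarrow> isotopism set" where
  "rrs_isotopisms n = {(\<alpha>, \<beta>, \<gamma>) \<in> isotopisms n. \<alpha> = \<beta>}"

definition isomorphisms :: "nat \<Rightarrow> isotopism set" where
  "isomorphisms n = {(\<alpha>, \<beta>, \<gamma>) \<in> isotopisms n. \<alpha> = \<beta> \<and> \<beta> = \<gamma>}"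

fun apply_isotopism :: "isotopism \<Rightarrow> triple set \<Rightarrow> triple set" where
  "apply_isotopism (\<alpha>, \<beta>, \<gamma>) L = (\<lambda>(r, c, s). (\<alpha> r, \<beta> c, \<gamma> s)) ` L"

definition rrs_isotopic :: "nat \<Rightarrow> triple set \<Rightarrow> triple set \<Rightarrow> bool" where
  "rrs_isotopic n L L' \<longleftrightarrow> (\<exists>\<theta> \<in> rrs_isotopisms n. apply_isotopism \<theta> L = L')"

definition isomorphic :: "nat \<Rightarrow> triple set \<Rightarrow> triple set \<Rightarrow> bool" where
  "isomorphic n L L' \<longleftrightarrow> (\<exists>\<theta> \<in> isomorphisms n. apply_isotopism \<theta> L = L')"

definition isomorphism_classes :: "nat \<Rightarrow> triple set set \<Rightarrow> triple set set set" where
  "isomorphism_classes n S = S // {(A, B). A \<in> S \<and> B \<in> S \<and> isomorphic n A B}"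

definition rrs_autotopism_group :: "nat \<Rightarrow> triple set \<Rightarrow> isotopism set" where
  "rrs_autotopism_group n L = {\<theta> \<in> rrs_isotopisms n. apply_isotopism \<theta> L = L}"

text \<open>The multiset of the lengths of the cycles of \<open>p\<close> on \<open>{1..n}\<close>, that is, of the sizes
  of its orbits; fixed points contribute cycles of length 1.\<close>
definition cycle_structure :: "nat \<Rightarrow> (nat \<Rightarrow> nat) \<Rightarrow> nat multiset" where
  "cycle_structure n p = image_mset card (mset_set (orbit p ` {1..n}))"

definition psi :: "nat \<Rightarrow> (nat \<Rightarrow> nat) \<Rightarrow> (nat \<Rightarrow> nat) \<Rightarrow> nat" where
  "psi n \<alpha> \<beta> =
     (if cycle_structure n \<alpha> = cycle_structure n \<beta>
      then \<Prod>c \<in> set_mset (cycle_structure n \<alpha>).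
             fact (count (cycle_structure n \<alpha>) c) * c ^ count (cycle_structure n \<alpha>) c
      else 0)"

end

theory Submission
  imports "HOL-Algebra.Group_Action" "HOL-Combinatorics.Cycles" Defs
begin

text \<open>
  Every square rrs-isotopic to \<open>L\<close> is isomorphic to some \<open>(id, id, \<tau>) L\<close>, and two such squares,
  for \<open>\<tau>\<close> and \<open>\<tau>'\<close>, are isomorphic iff \<open>\<tau>' = \<alpha> \<tau> \<beta>\<^sup>-\<^sup>1\<close> for some \<open>(\<alpha>, \<alpha>, \<beta>)\<close> in the
  rrs-autotopism group. So the isomorphism classes correspond to the orbits of that group on the
  symmetric group, and by Burnside's lemma it remains to see that \<open>\<psi>(\<alpha>, \<beta>)\<close> counts the \<open>\<tau>\<close> with
  \<open>\<alpha> \<tau> = \<tau> \<beta>\<close>. Such a \<open>\<tau>\<close> may send a chosen point of a \<open>c\<close>-cycle of \<open>\<beta>\<close> to any of the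
  \<open>c n\<^sub>c\<close> points on \<open>c\<close>-cycles of \<open>\<alpha>\<close>; this determines \<open>\<tau>\<close> on the cycle, and the count follows
  by induction after removing the two cycles.
\<close>

unbundle no m_inv_syntax

subsection \<open>Permutations intertwining two permutations\<close>

text \<open>This is \<open>cycle_structure\<close> with the carrier set as a parameter, so that
  cycles can be removed from the set while the permutation itself stays unchanged.\<close>

definition cycle_lengths :: "('a \<Rightarrow> 'a) \<Rightarrow> 'a set \<Rightarrow> nat multiset" where
  "cycle_lengths p A = image_mset card (mset_set (orbit p ` A))"

text \<open>This is the order of the centralizer of a permutation with cycle type
  \<open>M\<close>.\<close>

definition cycle_weight :: "nat multiset \<Rightarrow> nat" where
  "cycle_weight M = (\<Prod>c \<in> set_mset M. fact (count M c) * c ^ count M c)"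

text \<open>Extensional functions are used so that a map is determined by its values on
  \<open>A\<close>. Separate sets \<open>A\<close> and \<open>B\<close> are needed because the
  cycles removed from the two sides differ.\<close>

definition equivariant_bijections ::
    "('a \<Rightarrow> 'a) \<Rightarrow> 'a set \<Rightarrow> ('b \<Rightarrow> 'b) \<Rightarrow> 'b set \<Rightarrow> ('a \<Rightarrow> 'b) set" where
  "equivariant_bijections p A q B =
     {\<rho> \<in> A \<rightarrow>\<^sub>E B. bij_betw \<rho> A B \<and> (\<forall>x\<in>A. \<rho> (p x) = q (\<rho> x))}"

text \<open>Only the factor at \<open>c\<close> changes: with \<open>k = count M c\<close>, it goes
  from \<open>k! c^k\<close> to \<open>(k+1)! c^(k+1)\<close>. The quotient \<open>c * (k+1)\<close>
  will be the number of possible images of one point on a \<open>c\<close>-cycle.\<close>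

lemma cycle_weight_add_mset:
  "cycle_weight (add_mset c M) = c * Suc (count M c) * cycle_weight M"
proof -
  let ?t = "\<lambda>M c. fact (count M c) * c ^ count M c :: nat"
  \<comment> \<open>If \<open>c\<close> does not occur in \<open>M\<close>, its factor is
    \<open>fact 0 * c ^ 0 = 1\<close>, so it may be inserted in any case.\<close>
  have "cycle_weight M = prod (?t M) (insert c (set_mset M))"
    unfolding cycle_weight_def
    by (rule prod.mono_neutral_left) (auto simp: not_in_iff)
  also have "\<dots> = ?t M c * prod (?t M) (set_mset M - {c})"
    by (rule prod.insert_remove) simp
  finally have M: "cycle_weight M = ?t M c * prod (?t M) (set_mset M - {c})" .
  have "cycle_weight (add_mset c M) = prod (?t (add_mset c M)) (insert c (set_mset M))"
    by (simp add: cycle_weight_def)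
  also have "\<dots> = ?t (add_mset c M) c * prod (?t (add_mset c M)) (set_mset M - {c})"
    by (rule prod.insert_remove) simp
  also have "prod (?t (add_mset c M)) (set_mset M - {c}) = prod (?t M) (set_mset M - {c})"
    by (rule prod.cong) auto
  finally show ?thesis
    unfolding M by (simp add: algebra_simps)
qed

section \<open>Orbits and cycle lengths of a permutation\<close>

lemma permutation_orbit_eq:
  assumes "permutation p" "y \<in> orbit p x"
  shows "orbit p y = orbit p x"
  using cyclic_on_orbit'[OF assms(1)] assms(2) by (rule orbit_cyclic_eq3)

lemma orbit_subset_closed:
  assumes "\<And>x. x \<in> A \<Longrightarrow> p x \<in> A" "x \<in> A"
  shows "orbit p x \<subseteq> A"
proof
  fix y assume "y \<in> orbit p x"
  then show "y \<in> A" by induct (use assms in auto)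
qed

text \<open>Orbits of a permutation are equal or disjoint, so a point outside an orbit cannot step
  into it. Hence the same \<open>p\<close> still acts on what is left after a cycle is
  removed.\<close>

lemma closed_diff_orbit:
  assumes "permutation p" "\<And>x. x \<in> A \<Longrightarrow> p x \<in> A" "x \<in> A - orbit p a"
  shows "p x \<in> A - orbit p a"
  using assms permutation_orbit_eq[OF assms(1)] permutation_orbit_step[OF assms(1)]
    permutation_self_in_orbit[OF assms(1)] by (metis Diff_iff)

text \<open>The iterates of \<open>x\<close> below the least power fixing it list the orbit without
  repetition. This makes the divisibility criterion for \<open>least_power\<close> available for
  orbit sizes.\<close>

lemma card_orbit_eq_least_power:
  assumes "permutation p"
  shows "card (orbit p x) = least_power p x"
proof -
  have "orbit p x = set (support p x)"
    using orbit_altdef_bounded[OF least_power_of_permutation[OF assms, of x]] by auto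
  then show ?thesis
    using distinct_card[OF cycle_of_permutation[OF assms, of x]] by simp
qed

lemma funpow_eq_iff_dvd:
  assumes "permutation p" "i \<le> j"
  shows "(p ^^ i) x = (p ^^ j) x \<longleftrightarrow> card (orbit p x) dvd j - i"
proof -
  have "inj (p ^^ i)"
    using assms(1) by (simp add: permutation bij_is_inj inj_fn)
  moreover have "(p ^^ j) x = (p ^^ i) ((p ^^ (j - i)) x)"
    using assms(2) by (metis comp_apply funpow_add le_add_diff_inverse)
  ultimately show ?thesis
    by (metis assms(1) card_orbit_eq_least_power inj_eq least_power_dvd)
qed

text \<open>Coincidences among iterates depend only on the cycle length. So sending
  \<open>(p ^^ k) x\<close> to \<open>(q ^^ k) y\<close> is both well defined and injective.\<close>

lemma funpow_eq_iff_of_card_orbit_eq: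
  assumes "permutation p" "permutation q" "card (orbit p x) = card (orbit q y)"
  shows "(p ^^ i) x = (p ^^ j) x \<longleftrightarrow> (q ^^ i) y = (q ^^ j) y"
  using assms funpow_eq_iff_dvd by (metis nle_le)

lemma cycle_lengths_remove_orbit:
  assumes "permutation p" "finite A" "a \<in> A"
  shows "cycle_lengths p A = add_mset (card (orbit p a)) (cycle_lengths p (A - orbit p a))"
proof -
  have "orbit p ` A = insert (orbit p a) (orbit p ` (A - orbit p a))"
    using assms(3) permutation_orbit_eq[OF assms(1)] by auto
  moreover have "orbit p a \<notin> orbit p ` (A - orbit p a)"
    using permutation_self_in_orbit[OF assms(1)] by auto
  ultimately show ?thesis
    using assms(2) by (simp add: cycle_lengths_def)
qed

text \<open>These points form the disjoint union of the orbits of size \<open>c\<close>; closure of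
  \<open>A\<close> under \<open>p\<close> ensures that such orbits lie inside
  \<open>A\<close>.\<close>

lemma card_points_with_orbit_card:
  assumes "permutation p" "finite A" "\<And>x. x \<in> A \<Longrightarrow> p x \<in> A"
  shows "card {x \<in> A. card (orbit p x) = c} = c * count (cycle_lengths p A) c"
proof -
  let ?P = "{C \<in> orbit p ` A. card C = c}"
  have "{x \<in> A. card (orbit p x) = c} = \<Union>?P"
    using orbit_subset_closed[of A p] assms(3) permutation_orbit_eq[OF assms(1)]
      permutation_self_in_orbit[OF assms(1)] by fastforce
  moreover have "card (\<Union>?P) = (\<Sum>C\<in>?P. card C)"
  proof (rule card_Union_disjoint)
    show "pairwise disjnt ?P"
      unfolding pairwise_def disjnt_iff using permutation_orbit_eq[OF assms(1)] by blast
    show "\<And>C. C \<in> ?P \<Longrightarrow> finite C"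
      using finite_orbit[OF permutation_self_in_orbit[OF assms(1)]] by auto
  qed
  moreover have "count (cycle_lengths p A) c = card ?P"
  proof -
    have "count (cycle_lengths p A) c = (\<Sum>C\<in>?P. count (mset_set (orbit p ` A)) C)"
      unfolding cycle_lengths_def count_image_mset' using assms(2)
      by (intro sum.cong) auto
    also have "\<dots> = (\<Sum>C\<in>?P. 1)"
      using assms(2) by (intro sum.cong) auto
    finally show ?thesis by simp
  qed
  ultimately show ?thesis by simp
qed

section \<open>Counting equivariant bijections by removing cycles\<close>

lemma equivariant_image_orbit:
  assumes "permutation p" "\<And>x. x \<in> A \<Longrightarrow> p x \<in> A" "a \<in> A"
    and "\<rho> \<in> equivariant_bijections p A q B"
  shows "\<rho> ` orbit p a = orbit q (\<rho> a)"
proof (rule orbit_inverse)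
  show "a \<in> orbit p a" by (rule permutation_self_in_orbit[OF assms(1)])
  show "q (\<rho> x) = \<rho> (p x)" if "x \<in> orbit p a" for x
    using that assms(4) orbit_subset_closed[of A p a] assms(2,3)
    by (auto simp: equivariant_bijections_def)
qed

text \<open>Once \<open>\<rho> a = b\<close>, equivariance forces
  \<open>\<rho> ((p ^^ k) a) = (q ^^ k) b\<close>, so nothing on the cycle of \<open>a\<close>
  remains to be chosen. Conversely, equal cycle lengths make this prescription consistent, and it
  can be glued to any equivariant bijection between the complements.\<close>

lemma bij_betw_restrict_off_orbit:
  assumes p: "permutation p" and q: "permutation q"
    and A: "\<And>x. x \<in> A \<Longrightarrow> p x \<in> A" and B: "\<And>y. y \<in> B \<Longrightarrow> q y \<in> B"
    and a: "a \<in> A" and b: "b \<in> B"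
    and card_eq: "card (orbit p a) = card (orbit q b)"
  shows "bij_betw (\<lambda>\<rho>. restrict \<rho> (A - orbit p a))
           {\<rho> \<in> equivariant_bijections p A q B. \<rho> a = b}
           (equivariant_bijections p (A - orbit p a) q (B - orbit q b))"
    (is "bij_betw ?r ?F ?E")
proof (rule bij_betw_imageI)
  let ?O = "orbit p a" and ?Q = "orbit q b"
  have OA: "?O \<subseteq> A" and QB: "?Q \<subseteq> B"
    using orbit_subset_closed[of A p a] orbit_subset_closed[of B q b] A B a b by auto
  have off: "p x \<in> A - ?O" if "x \<in> A - ?O" for x
    using closed_diff_orbit[OF p A that] .
  show "inj_on ?r ?F"
  proof (rule inj_onI)
    fix \<rho> \<sigma> assume \<rho>: "\<rho> \<in> ?F" and \<sigma>: "\<sigma> \<in> ?F" and eq: "?r \<rho> = ?r \<sigma>"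
    have on: "\<rho> x = \<sigma> x" if "x \<in> ?O" for x
      using that
    proof induct
      \<comment> \<open>The induction on \<open>orbit\<close> starts at \<open>p a\<close>, not at
        \<open>a\<close>, so the base case already uses equivariance once.\<close>
      case base
      show ?case using \<rho> \<sigma> a by (auto simp: equivariant_bijections_def)
    next
      case (step y)
      then show ?case using \<rho> \<sigma> OA by (auto simp: equivariant_bijections_def)
    qed
    have "\<rho> x = \<sigma> x" if "x \<in> A" for x
      using on fun_cong[OF eq, of x] that by (cases "x \<in> ?O") auto
    then show "\<rho> = \<sigma>"
      using \<rho> \<sigma> by (auto simp: equivariant_bijections_def intro: PiE_ext)
  qed
  have into: "?r \<rho> \<in> ?E" if "\<rho> \<in> ?F" for \<rho>
  proof -
    have img: "\<rho> ` ?O = ?Q"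
      using equivariant_image_orbit[OF p A a, of \<rho> q B] that by auto
    have bij: "bij_betw \<rho> A B" using that by (auto simp: equivariant_bijections_def)
    then have "bij_betw \<rho> (A - ?O) (B - ?Q)"
      using OA img by (auto simp: bij_betw_def inj_on_image_set_diff[of \<rho> A] intro: inj_on_subset)
    then have "bij_betw (?r \<rho>) (A - ?O) (B - ?Q)"
      by (subst bij_betw_cong[where g = \<rho>]) simp_all
    moreover have "?r \<rho> (p x) = q (?r \<rho> x)" if "x \<in> A - ?O" for x
      using off[OF that] that \<open>\<rho> \<in> ?F\<close> by (simp add: equivariant_bijections_def)
    moreover have "?r \<rho> \<in> (A - ?O) \<rightarrow>\<^sub>E (B - ?Q)"
      using bij_betw_apply[OF calculation(1)] by (intro PiE_I) (auto simp del: Diff_iff)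
    ultimately show ?thesis
      unfolding equivariant_bijections_def by simp
  qed
  have onto: "\<exists>\<rho>\<in>?F. ?r \<rho> = \<sigma>" if \<sigma>: "\<sigma> \<in> ?E" for \<sigma>
  proof -
    \<comment> \<open>\<open>funpow_dist p a x\<close> is an exponent that takes \<open>a\<close> to
      \<open>x\<close>; the same number of steps is made from \<open>b\<close>.\<close>
    define \<rho> where "\<rho> x = (if x \<in> ?O then (q ^^ funpow_dist p a x) b else \<sigma> x)" for x
    have O: "?O = {(p ^^ k) a | k. True}" and Q: "?Q = {(q ^^ k) b | k. True}"
      by (rule orbit_altdef_permutation[OF p], rule orbit_altdef_permutation[OF q])
    \<comment> \<open>Any other exponent reaching the same point gives the same value, since the two
      cycles have equal length.\<close>
    have iter: "\<rho> ((p ^^ k) a) = (q ^^ k) b" for k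
    proof -
      have "(p ^^ k) a \<in> ?O" using O by auto
      moreover from funpow_dist_prop[OF this]
      have "(q ^^ funpow_dist p a ((p ^^ k) a)) b = (q ^^ k) b"
        using funpow_eq_iff_of_card_orbit_eq[OF p q card_eq] by blast
      ultimately show ?thesis by (simp add: \<rho>_def)
    qed
    have "bij_betw \<rho> ?O ?Q"
    proof (rule bij_betw_imageI)
      show "inj_on \<rho> ?O"
        unfolding O by (auto simp: inj_on_def iter funpow_eq_iff_of_card_orbit_eq[OF p q card_eq])
      show "\<rho> ` ?O = ?Q"
        unfolding O Q by (auto simp: iter image_iff) (metis iter)
    qed
    moreover have "bij_betw \<rho> (A - ?O) (B - ?Q)"
      using \<sigma> by (subst bij_betw_cong[where g = \<sigma>]) (auto simp: equivariant_bijections_def \<rho>_def)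
    ultimately have "bij_betw \<rho> (?O \<union> (A - ?O)) (?Q \<union> (B - ?Q))"
      by (rule bij_betw_combine) auto
    then have bij: "bij_betw \<rho> A B"
      using OA QB by (simp add: Un_absorb1)
    have "\<rho> (p x) = q (\<rho> x)" if "x \<in> A" for x
    proof (cases "x \<in> ?O")
      case True
      then obtain k where "x = (p ^^ k) a" using O by auto
      then show ?thesis using iter[of k] iter[of "Suc k"] by simp
    next
      case False
      then show ?thesis using \<sigma> that off[of x] by (auto simp: equivariant_bijections_def \<rho>_def)
    qed
    moreover have "\<rho> \<in> extensional A"
      using \<sigma> OA by (auto simp: \<rho>_def equivariant_bijections_def extensional_def PiE_def)
    moreover have "\<rho> a = b" using iter[of 0] by simp
    ultimately have "\<rho> \<in> ?F"
      using bij by (auto simp: equivariant_bijections_def PiE_def bij_betw_apply)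
    moreover have "?r \<rho> = \<sigma>"
      using \<sigma> by (auto simp: fun_eq_iff \<rho>_def equivariant_bijections_def restrict_def PiE_def
          extensional_def)
    ultimately show ?thesis by blast
  qed
  show "?r ` ?F = ?E" using into onto by blast
qed

lemma finite_equivariant_bijections:
  assumes "finite A" "finite B"
  shows "finite (equivariant_bijections p A q B)"
  using finite_subset[OF _ finite_PiE[of A "\<lambda>_. B"]] assms
  by (auto simp: equivariant_bijections_def)

text \<open>The maps are sorted by the image \<open>b\<close> of one fixed point \<open>a\<close>.
  Such a \<open>b\<close> lies on a cycle as long as that of \<open>a\<close>, and every fibre is an
  instance of the same problem with one cycle removed on each side. The recursion obtained is that
  of \<open>cycle_weight_add_mset\<close>.\<close>

lemma card_equivariant_bijections:
  assumes p: "permutation p" and q: "permutation q"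
    and "finite A" "finite B"
    and "\<And>x. x \<in> A \<Longrightarrow> p x \<in> A" "\<And>y. y \<in> B \<Longrightarrow> q y \<in> B"
  shows "card (equivariant_bijections p A q B) =
    (if cycle_lengths p A = cycle_lengths q B then cycle_weight (cycle_lengths p A) else 0)"
  using assms(3-)
proof (induction "card A" arbitrary: A B rule: less_induct)
  case less
  show ?case
  proof (cases "A = {}")
    case True
    \<comment> \<open>The only extensional map on the empty set is \<open>undefined\<close>
      everywhere; it is counted once, matching the empty product.\<close>
    have "equivariant_bijections p {} q B = (if B = {} then {\<lambda>_. undefined} else {})"
      by (auto simp: equivariant_bijections_def bij_betw_def)
    moreover have "cycle_lengths q B = {#} \<longleftrightarrow> B = {}"
      using less.prems(2) by (auto simp: cycle_lengths_def mset_set_empty_iff)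
    moreover have "cycle_lengths p {} = {#}" by (simp add: cycle_lengths_def)
    ultimately show ?thesis
      using True by (auto simp: cycle_weight_def)
  next
    case False
    then obtain a where a: "a \<in> A" by blast
    define A' where "A' = A - orbit p a"
    define c where "c = card (orbit p a)"
    \<comment> \<open>This is the common size of all fibres. Both sides lose a cycle of length
      \<open>c\<close>, so comparing the full cycle lengths is the same as comparing the reduced
      ones, and the condition does not depend on \<open>b\<close>.\<close>
    define w where "w = (if cycle_lengths p A = cycle_lengths q B
                         then cycle_weight (cycle_lengths p A') else 0)"
    let ?E = "equivariant_bijections p A q B"
    let ?Bc = "{b \<in> B. card (orbit q b) = c}"
    have A: "cycle_lengths p A = add_mset c (cycle_lengths p A')"
      using cycle_lengths_remove_orbit[OF p less.prems(1) a] by (simp add: A'_def c_def)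
    have "card A' < card A"
      unfolding A'_def using less.prems(1) a permutation_self_in_orbit[OF p, of a]
      by (intro psubset_card_mono) auto
    note IH = less.hyps[OF this]
    have fiber: "card {\<rho> \<in> ?E. \<rho> a = b} = w" if b: "b \<in> ?Bc" for b
    proof -
      have "card {\<rho> \<in> ?E. \<rho> a = b} = card (equivariant_bijections p A' q (B - orbit q b))"
        unfolding A'_def using b less.prems a
        by (intro bij_betw_same_card[OF bij_betw_restrict_off_orbit[OF p q]]) (auto simp: c_def)
      also have "\<dots> = (if cycle_lengths p A' = cycle_lengths q (B - orbit q b)
                        then cycle_weight (cycle_lengths p A') else 0)"
        using less.prems closed_diff_orbit[OF p, of A] closed_diff_orbit[OF q, of B]
        by (intro IH) (auto simp: A'_def)
      also have "\<dots> = w"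
        using cycle_lengths_remove_orbit[OF q less.prems(2), of b] b by (auto simp: w_def A)
      finally show ?thesis .
    qed
    have "?E = (\<Union>b\<in>?Bc. {\<rho> \<in> ?E. \<rho> a = b})"
    proof -
      \<comment> \<open>An injective equivariant map carries the orbit of \<open>a\<close> onto the
        orbit of \<open>\<rho> a\<close>, so the two have the same size.\<close>
      have "\<rho> a \<in> ?Bc" if "\<rho> \<in> ?E" for \<rho>
      proof -
        have "bij_betw \<rho> A B" using that by (simp add: equivariant_bijections_def)
        then have "inj_on \<rho> (orbit p a)" "\<rho> a \<in> B"
          using orbit_subset_closed[of A p a] less.prems(3) a
          by (auto simp: bij_betw_def intro: inj_on_subset)
        then show ?thesis
          using equivariant_image_orbit[OF p less.prems(3) a that] card_image
          by (fastforce simp: c_def)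
      qed
      then show ?thesis by blast
    qed
    then have "card ?E = card (\<Union>b\<in>?Bc. {\<rho> \<in> ?E. \<rho> a = b})" by simp
    also have "\<dots> = (\<Sum>b\<in>?Bc. card {\<rho> \<in> ?E. \<rho> a = b})"
      using less.prems(1,2) by (intro card_UN_disjoint) (auto simp: finite_equivariant_bijections)
    also have "\<dots> = card ?Bc * w"
      using fiber by simp
    also have "card ?Bc = c * count (cycle_lengths q B) c"
      using less.prems by (intro card_points_with_orbit_card[OF q])
    \<comment> \<open>If the cycle lengths agree, the count of \<open>c\<close> for \<open>B\<close>
      is one more than that for \<open>A'\<close>, as the recursion requires; otherwise
      \<open>w = 0\<close>.\<close>
    also have "c * count (cycle_lengths q B) c * w =
      (if cycle_lengths p A = cycle_lengths q B then cycle_weight (cycle_lengths p A) else 0)"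
      unfolding w_def A by (auto simp: cycle_weight_add_mset dest: sym)
    finally show ?thesis .
  qed
qed

text \<open>A permutation of \<open>S\<close> is a total function that is the identity off
  \<open>S\<close>, while an equivariant bijection is undefined there. Restriction and extension by
  the identity translate between the two.\<close>

lemma card_conjugating_permutations:
  assumes S: "finite S" and \<alpha>: "\<alpha> permutes S" and \<beta>: "\<beta> permutes S"
  shows "card {\<tau>. \<tau> permutes S \<and> \<tau> \<circ> \<alpha> = \<beta> \<circ> \<tau>} =
    (if cycle_lengths \<alpha> S = cycle_lengths \<beta> S then cycle_weight (cycle_lengths \<alpha> S) else 0)"
proof -
  have in_iff: "\<alpha> x \<in> S \<longleftrightarrow> x \<in> S" "\<beta> x \<in> S \<longleftrightarrow> x \<in> S" for x
    using permutes_in_image[OF \<alpha>] permutes_in_image[OF \<beta>] by auto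
  have "bij_betw (\<lambda>\<tau>. restrict \<tau> S) {\<tau>. \<tau> permutes S \<and> \<tau> \<circ> \<alpha> = \<beta> \<circ> \<tau>}
          (equivariant_bijections \<alpha> S \<beta> S)"
  proof (rule bij_betw_byWitness[where f' = "\<lambda>\<rho> x. if x \<in> S then \<rho> x else x"])
    show "\<forall>\<tau>\<in>{\<tau>. \<tau> permutes S \<and> \<tau> \<circ> \<alpha> = \<beta> \<circ> \<tau>}.
        (\<lambda>x. if x \<in> S then restrict \<tau> S x else x) = \<tau>"
      by (auto simp: fun_eq_iff permutes_def)
    show "\<forall>\<rho>\<in>equivariant_bijections \<alpha> S \<beta> S.
        restrict (\<lambda>x. if x \<in> S then \<rho> x else x) S = \<rho>"
      by (auto simp: equivariant_bijections_def fun_eq_iff PiE_def extensional_def)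
    show "(\<lambda>\<tau>. restrict \<tau> S) ` {\<tau>. \<tau> permutes S \<and> \<tau> \<circ> \<alpha> = \<beta> \<circ> \<tau>}
        \<subseteq> equivariant_bijections \<alpha> S \<beta> S"
    proof safe
      fix \<tau> assume \<tau>: "\<tau> permutes S" "\<tau> \<circ> \<alpha> = \<beta> \<circ> \<tau>"
      have "bij_betw (restrict \<tau> S) S S"
        using permutes_imp_bij[OF \<tau>(1)] by (simp cong: bij_betw_cong)
      then show "restrict \<tau> S \<in> equivariant_bijections \<alpha> S \<beta> S"
        using in_iff(1) fun_cong[OF \<tau>(2)] permutes_in_image[OF \<tau>(1)]
        unfolding equivariant_bijections_def by auto
    qed
    show "(\<lambda>\<rho> x. if x \<in> S then \<rho> x else x) ` equivariant_bijections \<alpha> S \<beta> S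
        \<subseteq> {\<tau>. \<tau> permutes S \<and> \<tau> \<circ> \<alpha> = \<beta> \<circ> \<tau>}"
    proof (rule image_subsetI)
      fix \<rho> assume \<rho>: "\<rho> \<in> equivariant_bijections \<alpha> S \<beta> S"
      let ?\<tau> = "\<lambda>x. if x \<in> S then \<rho> x else x"
      have "bij_betw ?\<tau> S S"
        using \<rho> by (simp add: equivariant_bijections_def cong: bij_betw_cong)
      then have "?\<tau> permutes S" by (rule bij_imp_permutes) simp
      moreover have "?\<tau> (\<alpha> x) = \<beta> (?\<tau> x)" for x
      proof (cases "x \<in> S")
        case True
        then show ?thesis using \<rho> in_iff(1)[of x] by (auto simp: equivariant_bijections_def)
      next
        case False
        then show ?thesis
          using in_iff(1)[of x] permutes_not_in[OF \<alpha> False] permutes_not_in[OF \<beta> False]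
          by (simp only: if_False)
      qed
      ultimately show "?\<tau> \<in> {\<tau>. \<tau> permutes S \<and> \<tau> \<circ> \<alpha> = \<beta> \<circ> \<tau>}"
        unfolding mem_Collect_eq comp_def by blast
    qed
  qed
  then have "card {\<tau>. \<tau> permutes S \<and> \<tau> \<circ> \<alpha> = \<beta> \<circ> \<tau>} =
      card (equivariant_bijections \<alpha> S \<beta> S)"
    by (rule bij_betw_same_card)
  also have "\<dots> = (if cycle_lengths \<alpha> S = cycle_lengths \<beta> S
      then cycle_weight (cycle_lengths \<alpha> S) else 0)"
    using S \<alpha> \<beta> in_iff by (intro card_equivariant_bijections) (auto simp: permutation_permutes)
  finally show ?thesis .
qed

lemma psi_eq_card:
  assumes "\<alpha> permutes {1..n}" "\<beta> permutes {1..n}"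
  shows "psi n \<alpha> \<beta> = card {\<tau>. \<tau> permutes {1..n} \<and> \<tau> \<circ> \<alpha> = \<beta> \<circ> \<tau>}"
  using assms
  by (simp add: card_conjugating_permutations psi_def cycle_structure_def cycle_lengths_def
      cycle_weight_def)

subsection \<open>The action on symbol permutations\<close>

lemma apply_isotopism_comp:
  "apply_isotopism (\<alpha>, \<beta>, \<gamma>) (apply_isotopism (\<alpha>', \<beta>', \<gamma>') L) =
   apply_isotopism (\<alpha> \<circ> \<alpha>', \<beta> \<circ> \<beta>', \<gamma> \<circ> \<gamma>') L"
  by (simp add: image_image case_prod_beta)

lemma apply_isotopism_id: "apply_isotopism (id, id, id) L = L"
  by (simp add: case_prod_beta)

lemma mem_rrs_autotopism_group:
  "(\<alpha>, \<alpha>', \<beta>) \<in> rrs_autotopism_group n L \<longleftrightarrow>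
   \<alpha>' = \<alpha> \<and> \<alpha> permutes {1..n} \<and> \<beta> permutes {1..n} \<and> apply_isotopism (\<alpha>, \<alpha>, \<beta>) L = L"
  by (auto simp: rrs_autotopism_group_def rrs_isotopisms_def isotopisms_def)

lemma rrs_isotopic_iff:
  "rrs_isotopic n L L' \<longleftrightarrow>
   (\<exists>\<alpha> \<beta>. \<alpha> permutes {1..n} \<and> \<beta> permutes {1..n} \<and> apply_isotopism (\<alpha>, \<alpha>, \<beta>) L = L')"
  by (auto simp: rrs_isotopic_def rrs_isotopisms_def isotopisms_def)

lemma isomorphic_iff:
  "isomorphic n L L' \<longleftrightarrow> (\<exists>\<sigma>. \<sigma> permutes {1..n} \<and> apply_isotopism (\<sigma>, \<sigma>, \<sigma>) L = L')"
  by (auto simp: isomorphic_def isomorphisms_def isotopisms_def)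

lemma apply_isotopism_eq_iff:
  assumes "\<alpha> permutes {1..n}" "\<beta> permutes {1..n}"
  shows "apply_isotopism (\<alpha>, \<alpha>, \<beta>) L = L' \<longleftrightarrow> L = apply_isotopism (inv \<alpha>, inv \<alpha>, inv \<beta>) L'"
  using assms
  by (auto simp only: apply_isotopism_comp permutes_inv_o apply_isotopism_id)

text \<open>Injective relabelling preserves the Latin condition, and it commutes with transposition
  because rows and columns are permuted by the same \<open>\<alpha>\<close>.\<close>

lemma symmetric_latin_square_apply_isotopism:
  assumes L: "symmetric_latin_square n L" and \<alpha>: "\<alpha> permutes {1..n}" and \<beta>: "\<beta> permutes {1..n}"
  shows "symmetric_latin_square n (apply_isotopism (\<alpha>, \<alpha>, \<beta>) L)"
proof -
  have inj: "\<alpha> x = \<alpha> y \<longleftrightarrow> x = y" "\<beta> x = \<beta> y \<longleftrightarrow> x = y" for x y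
    using permutes_inj[OF \<alpha>] permutes_inj[OF \<beta>] by (auto simp: inj_eq)
  let ?f = "\<lambda>(r, c, s). (\<alpha> r, \<alpha> c, \<beta> s)"
  have "card (?f ` L) = card L"
    by (rule card_image) (auto simp: inj_on_def inj)
  moreover have "?f ` L \<subseteq> {1..n} \<times> {1..n} \<times> {1..n}"
    using L permutes_in_image[OF \<alpha>] permutes_in_image[OF \<beta>]
    by (fastforce simp: symmetric_latin_square_def latin_square_def)
  moreover have "latin_transpose (?f ` L) = ?f ` latin_transpose L"
    by (simp add: latin_transpose_def image_image case_prod_beta)
  moreover have "\<forall>(r, c, s) \<in> ?f ` L. \<forall>(r', c', s') \<in> ?f ` L. (r, c, s) \<noteq> (r', c', s') \<longrightarrow>
        \<not> (r = r' \<and> c = c') \<and> \<not> (r = r' \<and> s = s') \<and> \<not> (c = c' \<and> s = s')"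
    using L unfolding symmetric_latin_square_def latin_square_def ball_simps(9)
    by (simp add: case_prod_beta prod_eq_iff inj) blast
  ultimately show ?thesis
    using L unfolding symmetric_latin_square_def latin_square_def by simp
qed

lemma equiv_isomorphic:
  "equiv S {(A, B). A \<in> S \<and> B \<in> S \<and> isomorphic n A B}"
proof (rule equivI)
  show "{(A, B). A \<in> S \<and> B \<in> S \<and> isomorphic n A B} \<subseteq> S \<times> S" by auto
  show "refl_on S {(A, B). A \<in> S \<and> B \<in> S \<and> isomorphic n A B}"
    unfolding refl_on_def isomorphic_iff using permutes_id apply_isotopism_id by blast
  show "sym {(A, B). A \<in> S \<and> B \<in> S \<and> isomorphic n A B}"
    unfolding sym_def isomorphic_iff using permutes_inv apply_isotopism_eq_iff by blast
  show "trans {(A, B). A \<in> S \<and> B \<in> S \<and> isomorphic n A B}"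
    unfolding trans_def isomorphic_iff using permutes_compose apply_isotopism_comp by blast
qed

section \<open>The rrs-autotopism group acting on permutations\<close>

definition rrs_autotopism_monoid :: "nat \<Rightarrow> triple set \<Rightarrow> isotopism monoid" where
  "rrs_autotopism_monoid n L =
     \<lparr>carrier = rrs_autotopism_group n L,
      monoid.mult = (\<lambda>(\<alpha>, \<alpha>', \<beta>) (\<gamma>, \<gamma>', \<delta>). (\<alpha> \<circ> \<gamma>, \<alpha>' \<circ> \<gamma>', \<beta> \<circ> \<delta>)),
      one = (id, id, id)\<rparr>"

text \<open>The inverse on the right makes this a left action. The map is restricted to the
  permutations because the elements of \<open>Bij\<close> are extensional.\<close>

definition translate :: "nat \<Rightarrow> isotopism \<Rightarrow> (nat \<Rightarrow> nat) \<Rightarrow> (nat \<Rightarrow> nat)" where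
  "translate n = (\<lambda>(\<alpha>, \<alpha>', \<beta>). \<lambda>\<tau>\<in>{\<tau>. \<tau> permutes {1..n}}. \<alpha> \<circ> \<tau> \<circ> inv \<beta>)"

lemma group_rrs_autotopism_monoid: "group (rrs_autotopism_monoid n L)"
proof (rule groupI)
  fix x assume "x \<in> carrier (rrs_autotopism_monoid n L)"
  then obtain \<alpha> \<beta> where x: "x = (\<alpha>, \<alpha>, \<beta>)" and \<alpha>: "\<alpha> permutes {1..n}" and \<beta>: "\<beta> permutes {1..n}"
    and L: "apply_isotopism (\<alpha>, \<alpha>, \<beta>) L = L"
    by (cases x) (auto simp: rrs_autotopism_monoid_def mem_rrs_autotopism_group
        simp del: apply_isotopism.simps)
  have "(inv \<alpha>, inv \<alpha>, inv \<beta>) \<in> rrs_autotopism_group n L"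
    unfolding mem_rrs_autotopism_group using \<alpha> \<beta> L apply_isotopism_eq_iff[OF \<alpha> \<beta>]
    by (metis permutes_inv)
  then show "\<exists>y\<in>carrier (rrs_autotopism_monoid n L).
      y \<otimes>\<^bsub>rrs_autotopism_monoid n L\<^esub> x = \<one>\<^bsub>rrs_autotopism_monoid n L\<^esub>"
    using \<alpha> \<beta> by (intro bexI[of _ "(inv \<alpha>, inv \<alpha>, inv \<beta>)"])
      (auto simp: rrs_autotopism_monoid_def x permutes_inv_o)
qed (auto simp: rrs_autotopism_monoid_def mem_rrs_autotopism_group permutes_compose permutes_id
    apply_isotopism_id comp_assoc apply_isotopism_comp[symmetric] simp del: apply_isotopism.simps)

lemma group_action_translate:
  "group_action (rrs_autotopism_monoid n L) {\<tau>. \<tau> permutes {1..n}} (translate n)"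
proof -
  let ?E = "{\<tau>. \<tau> permutes {1..n}}"
  have bij: "translate n g \<in> Bij ?E" if gG: "g \<in> rrs_autotopism_group n L" for g
  proof -
    obtain \<alpha> \<beta> where g: "g = (\<alpha>, \<alpha>, \<beta>)" and \<alpha>: "\<alpha> permutes {1..n}" and \<beta>: "\<beta> permutes {1..n}"
      using gG by (cases g) (auto simp: mem_rrs_autotopism_group)
    note inv_o = permutes_inv_o[OF \<alpha>] permutes_inv_o[OF \<beta>]
    have "bij_betw (translate n g) ?E ?E"
    proof (rule bij_betw_byWitness[where f' = "\<lambda>\<tau>. inv \<alpha> \<circ> \<tau> \<circ> \<beta>"])
      have c: "\<alpha> \<circ> \<tau> \<circ> inv \<beta> \<in> ?E" "inv \<alpha> \<circ> \<tau> \<circ> \<beta> \<in> ?E" if "\<tau> \<in> ?E" for \<tau>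
        using that \<alpha> \<beta> by (auto intro!: permutes_compose permutes_inv)
      then show "translate n g ` ?E \<subseteq> ?E" "(\<lambda>\<tau>. inv \<alpha> \<circ> \<tau> \<circ> \<beta>) ` ?E \<subseteq> ?E"
        by (auto simp: g translate_def)
      show "\<forall>\<tau>\<in>?E. inv \<alpha> \<circ> translate n g \<tau> \<circ> \<beta> = \<tau>"
        by (auto simp: g translate_def fun_eq_iff permutes_inverses[OF \<alpha>] permutes_inverses[OF \<beta>])
      show "\<forall>\<tau>\<in>?E. translate n g (inv \<alpha> \<circ> \<tau> \<circ> \<beta>) = \<tau>"
        using c(2)
        by (auto simp: g translate_def fun_eq_iff permutes_inverses[OF \<alpha>] permutes_inverses[OF \<beta>])
    qed
    then show ?thesis by (auto simp: Bij_def translate_def g)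
  qed
  have "translate n (g \<otimes>\<^bsub>rrs_autotopism_monoid n L\<^esub> h) =
      translate n g \<otimes>\<^bsub>BijGroup ?E\<^esub> translate n h"
    if gG: "g \<in> rrs_autotopism_group n L" and hG: "h \<in> rrs_autotopism_group n L" for g h
  proof -
    obtain \<alpha> \<beta> where g: "g = (\<alpha>, \<alpha>, \<beta>)" and \<alpha>: "\<alpha> permutes {1..n}" and \<beta>: "\<beta> permutes {1..n}"
      using gG by (cases g) (auto simp: mem_rrs_autotopism_group)
    obtain \<gamma> \<delta> where h: "h = (\<gamma>, \<gamma>, \<delta>)" and \<gamma>: "\<gamma> permutes {1..n}" and \<delta>: "\<delta> permutes {1..n}"
      using hG by (cases h) (auto simp: mem_rrs_autotopism_group)
    have "inv (\<beta> \<circ> \<delta>) = inv \<delta> \<circ> inv \<beta>"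
      using \<beta> \<delta> by (simp add: o_inv_distrib permutes_bij)
    \<comment> \<open>The outer translation has the expected value only at permutations, so the
      inner result must be one.\<close>
    moreover have "\<gamma> \<circ> \<tau> \<circ> inv \<delta> \<in> ?E" if "\<tau> \<in> ?E" for \<tau>
      using that \<gamma> \<delta> by (auto intro!: permutes_compose permutes_inv)
    ultimately have "translate n (\<alpha> \<circ> \<gamma>, \<alpha> \<circ> \<gamma>, \<beta> \<circ> \<delta>) =
        compose ?E (translate n g) (translate n h)"
      by (auto simp: g h translate_def compose_def restrict_def fun_eq_iff)
    then show ?thesis
      using bij[OF gG] bij[OF hG]
      by (simp add: g h rrs_autotopism_monoid_def BijGroup_def)
  qed
  then show ?thesis
    using bij group_rrs_autotopism_monoid group_BijGroup
    by (auto simp: group_action_def group_hom_def group_hom_axioms_def hom_def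
        rrs_autotopism_monoid_def BijGroup_def)
qed

text \<open>An isomorphism \<open>\<sigma>\<close> between the two squares, followed by undoing
  \<open>\<tau>'\<close> on the symbols, gives an autotopism of \<open>L\<close> with symbol part
  \<open>\<beta> = inv \<tau>' \<circ> \<sigma> \<circ> \<tau>\<close>; solving for
  \<open>\<tau>'\<close> gives the translate. Conversely, the row part of the autotopism is the
  isomorphism.\<close>

lemma isomorphic_symbol_isotopes_iff:
  assumes \<tau>: "\<tau> permutes {1..n}" and \<tau>': "\<tau>' permutes {1..n}"
  shows "isomorphic n (apply_isotopism (id, id, \<tau>) L) (apply_isotopism (id, id, \<tau>') L) \<longleftrightarrow>
    (\<exists>g\<in>rrs_autotopism_group n L. translate n g \<tau> = \<tau>')"
proof
  assume "isomorphic n (apply_isotopism (id, id, \<tau>) L) (apply_isotopism (id, id, \<tau>') L)"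
  then obtain \<sigma> where \<sigma>: "\<sigma> permutes {1..n}"
    and "apply_isotopism (\<sigma>, \<sigma>, \<sigma> \<circ> \<tau>) L = apply_isotopism (id, id, \<tau>') L"
    by (auto simp only: isomorphic_iff apply_isotopism_comp comp_id)
  then have "L = apply_isotopism (id, id, inv \<tau>') (apply_isotopism (\<sigma>, \<sigma>, \<sigma> \<circ> \<tau>) L)"
    using apply_isotopism_eq_iff[OF permutes_id \<tau>', of L] by (metis inv_id)
  then have "apply_isotopism (\<sigma>, \<sigma>, inv \<tau>' \<circ> (\<sigma> \<circ> \<tau>)) L = L"
    by (simp only: apply_isotopism_comp id_comp)
  moreover define \<beta> where "\<beta> = inv \<tau>' \<circ> (\<sigma> \<circ> \<tau>)"
  moreover have \<beta>: "\<beta> permutes {1..n}"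
    unfolding \<beta>_def using \<sigma> \<tau> \<tau>' by (intro permutes_compose permutes_inv)
  ultimately have "(\<sigma>, \<sigma>, \<beta>) \<in> rrs_autotopism_group n L"
    using \<sigma> by (simp only: mem_rrs_autotopism_group simp_thms)
  moreover have "\<sigma> \<circ> \<tau> = \<tau>' \<circ> \<beta>"
    by (simp add: \<beta>_def fun_eq_iff permutes_inverses[OF \<tau>'])
  then have "\<sigma> \<circ> \<tau> \<circ> inv \<beta> = \<tau>'"
    by (simp only: comp_assoc permutes_inv_o[OF \<beta>] comp_id)
  then have "translate n (\<sigma>, \<sigma>, \<beta>) \<tau> = \<tau>'"
    using \<tau> by (simp add: translate_def)
  ultimately show "\<exists>g\<in>rrs_autotopism_group n L. translate n g \<tau> = \<tau>'" by blast
next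
  assume "\<exists>g\<in>rrs_autotopism_group n L. translate n g \<tau> = \<tau>'"
  then obtain \<alpha> \<beta> where \<alpha>: "\<alpha> permutes {1..n}" and \<beta>: "\<beta> permutes {1..n}"
    and L: "apply_isotopism (\<alpha>, \<alpha>, \<beta>) L = L" and \<tau>'_eq: "\<tau>' = \<alpha> \<circ> \<tau> \<circ> inv \<beta>"
    using \<tau> by (auto simp: mem_rrs_autotopism_group translate_def simp del: apply_isotopism.simps)
  have "\<tau>' \<circ> \<beta> = \<alpha> \<circ> \<tau>"
    by (simp add: \<tau>'_eq fun_eq_iff permutes_inverses[OF \<beta>])
  \<comment> \<open>Both sides are the image of \<open>L\<close> under
    \<open>(\<alpha>, \<alpha>, \<alpha> \<circ> \<tau>)\<close>.\<close>
  then have "apply_isotopism (\<alpha>, \<alpha>, \<alpha>) (apply_isotopism (id, id, \<tau>) L) =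
      apply_isotopism (id, id, \<tau>') (apply_isotopism (\<alpha>, \<alpha>, \<beta>) L)"
    by (simp only: apply_isotopism_comp comp_id id_comp)
  then show "isomorphic n (apply_isotopism (id, id, \<tau>) L) (apply_isotopism (id, id, \<tau>') L)"
    unfolding isomorphic_iff L using \<alpha> by blast
qed

section \<open>Isomorphism classes as orbits\<close>

lemma card_image_eq_card_image:
  assumes "\<And>x y. x \<in> E \<Longrightarrow> y \<in> E \<Longrightarrow> f x = f y \<longleftrightarrow> g x = g y"
  shows "card (f ` E) = card (g ` E)"
proof (rule bij_betw_same_card)
  \<comment> \<open>Since \<open>f\<close> and \<open>g\<close> have the same fibres on
    \<open>E\<close>, applying \<open>g\<close> to a chosen preimage under \<open>f\<close> does not
    depend on the choice.\<close>
  have sel: "inv_into E f (f x) \<in> E" "f (inv_into E f (f x)) = f x" if "x \<in> E" for x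
    using that by (auto simp: inv_into_into f_inv_into_f)
  then have "g (inv_into E f (f x)) = g x" if "x \<in> E" for x
    using that assms by blast
  then show "bij_betw (\<lambda>z. g (inv_into E f z)) (f ` E) (g ` E)"
    using assms by (auto simp: bij_betw_def inj_on_def image_image)
qed

text \<open>Two maps on the permutations are compared: \<open>\<tau>\<close> to the class of the
  isotope of \<open>L\<close> by \<open>(id, id, \<tau>)\<close>, and \<open>\<tau>\<close> to its
  orbit. Both are surjective and they identify the same pairs.\<close>

lemma card_isomorphism_classes:
  assumes L: "symmetric_latin_square n L"
  shows "card (isomorphism_classes n {L'. symmetric_latin_square n L' \<and> rrs_isotopic n L L'}) =
    card (orbits (rrs_autotopism_monoid n L) {\<tau>. \<tau> permutes {1..n}} (translate n))"
proof -
  define S where "S = {L'. symmetric_latin_square n L' \<and> rrs_isotopic n L L'}"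
  define R where "R = {(A, B). A \<in> S \<and> B \<in> S \<and> isomorphic n A B}"
  let ?E = "{\<tau>. \<tau> permutes {1..n}}"
  let ?f = "\<lambda>\<tau>. apply_isotopism (id, id, \<tau>) L"
  let ?orb = "Group_Action.orbit (rrs_autotopism_monoid n L) (translate n)"
  interpret group_action "rrs_autotopism_monoid n L" ?E "translate n"
    by (rule group_action_translate)
  have R: "equiv S R"
    unfolding R_def by (rule equiv_isomorphic)
  have mem: "apply_isotopism (\<alpha>, \<alpha>, \<beta>) L \<in> S" if "\<alpha> permutes {1..n}" "\<beta> permutes {1..n}" for \<alpha> \<beta>
    using symmetric_latin_square_apply_isotopism[OF L that] that
    unfolding S_def mem_Collect_eq rrs_isotopic_iff by blast
  have f: "?f \<tau> \<in> S" if "\<tau> \<in> ?E" for \<tau>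
    using mem[OF permutes_id] that by blast
  have "\<exists>\<tau>\<in>?E. (?f \<tau>, A) \<in> R" if AS: "A \<in> S" for A
  proof -
    obtain \<alpha> \<beta> where \<alpha>: "\<alpha> permutes {1..n}" and \<beta>: "\<beta> permutes {1..n}"
      and A: "apply_isotopism (\<alpha>, \<alpha>, \<beta>) L = A"
      using AS unfolding S_def mem_Collect_eq rrs_isotopic_iff by blast
    \<comment> \<open>The isomorphism given by \<open>\<alpha>\<close> supplies the row and column
      parts; \<open>inv \<alpha>\<close> here cancels its effect on the symbols, leaving
      \<open>\<beta>\<close>.\<close>
    have \<tau>: "inv \<alpha> \<circ> \<beta> \<in> ?E"
      using \<alpha> \<beta> by (simp add: permutes_compose permutes_inv)
    have "\<alpha> \<circ> (inv \<alpha> \<circ> \<beta>) = \<beta>"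
      by (simp add: fun_eq_iff permutes_inverses[OF \<alpha>])
    then have "apply_isotopism (\<alpha>, \<alpha>, \<alpha>) (?f (inv \<alpha> \<circ> \<beta>)) = A"
      by (simp only: apply_isotopism_comp comp_id A)
    then have "isomorphic n (?f (inv \<alpha> \<circ> \<beta>)) A"
      unfolding isomorphic_iff using \<alpha> by blast
    then show ?thesis using \<tau> f[OF \<tau>] AS unfolding R_def by blast
  qed
  then have "R `` {A} \<in> (\<lambda>\<tau>. R `` {?f \<tau>}) ` ?E" if "A \<in> S" for A
    using equiv_class_eq[OF R] that by blast
  then have "S // R = (\<lambda>\<tau>. R `` {?f \<tau>}) ` ?E"
    using quotientI[OF f] by (intro equalityI subsetI) (auto elim!: quotientE)
  then have "card (isomorphism_classes n S) = card ((\<lambda>\<tau>. R `` {?f \<tau>}) ` ?E)"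
    by (simp only: isomorphism_classes_def R_def)
  also have "\<dots> = card (?orb ` ?E)"
  proof (rule card_image_eq_card_image)
    fix \<tau> \<tau>' assume \<tau>: "\<tau> \<in> ?E" and \<tau>': "\<tau>' \<in> ?E"
    have "R `` {?f \<tau>} = R `` {?f \<tau>'} \<longleftrightarrow> isomorphic n (?f \<tau>) (?f \<tau>')"
      using eq_equiv_class_iff[OF R f[OF \<tau>] f[OF \<tau>']] f[OF \<tau>] f[OF \<tau>'] by (simp only: R_def) blast
    also have "\<dots> \<longleftrightarrow> \<tau>' \<in> ?orb \<tau>"
      using isomorphic_symbol_isotopes_iff[of \<tau> n \<tau>' L] \<tau> \<tau>'
      by (auto simp: Group_Action.orbit_def rrs_autotopism_monoid_def)
    also have "\<dots> \<longleftrightarrow> ?orb \<tau> = ?orb \<tau>'"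
    proof
      assume "\<tau>' \<in> ?orb \<tau>"
      then show "?orb \<tau> = ?orb \<tau>'"
        using disjoint_union[of "?orb \<tau>" "?orb \<tau>'"] orbit_refl[OF \<tau>'] \<tau> \<tau>'
        unfolding orbits_def by blast
    next
      assume "?orb \<tau> = ?orb \<tau>'"
      then show "\<tau>' \<in> ?orb \<tau>" using orbit_refl[OF \<tau>'] by simp
    qed
    finally show "R `` {?f \<tau>} = R `` {?f \<tau>'} \<longleftrightarrow> ?orb \<tau> = ?orb \<tau>'" .
  qed
  also have "?orb ` ?E = orbits (rrs_autotopism_monoid n L) ?E (translate n)"
    by (auto simp: orbits_def)
  finally show ?thesis unfolding S_def .
qed

section \<open>Fixed points and Burnside's lemma\<close>

lemma card_invariants_translate:
  assumes "(\<alpha>, \<alpha>', \<beta>) \<in> rrs_autotopism_group n L"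
  shows "card (invariants {\<tau>. \<tau> permutes {1..n}} (translate n) (\<alpha>, \<alpha>', \<beta>)) = psi n \<alpha> \<beta>"
proof -
  have \<alpha>: "\<alpha> permutes {1..n}" and \<beta>: "\<beta> permutes {1..n}"
    using assms by (auto simp: mem_rrs_autotopism_group)
  have "\<alpha> \<circ> \<tau> \<circ> inv \<beta> = \<tau> \<longleftrightarrow> \<tau> \<circ> \<beta> = \<alpha> \<circ> \<tau>" for \<tau>
    by (metis \<beta> comp_assoc comp_id permutes_inv_o)
  then have "invariants {\<tau>. \<tau> permutes {1..n}} (translate n) (\<alpha>, \<alpha>', \<beta>) =
      {\<tau>. \<tau> permutes {1..n} \<and> \<tau> \<circ> \<beta> = \<alpha> \<circ> \<tau>}"
    by (auto simp: invariants_def translate_def)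
  \<comment> \<open>The count obtained is \<open>psi n \<beta> \<alpha>\<close>; it equals
    \<open>psi n \<alpha> \<beta>\<close> because a nonzero value depends only on the common cycle
    structure.\<close>
  then show ?thesis
    using psi_eq_card[OF \<beta> \<alpha>] by (auto simp: psi_def)
qed

theorem theorem5:
  fixes n :: nat and L :: "triple set"
  assumes "symmetric_latin_square n L"
  shows "real (card (isomorphism_classes n
             {L'. symmetric_latin_square n L' \<and> rrs_isotopic n L L'})) =
         1 / real (card (rrs_autotopism_group n L)) *
           (\<Sum>(\<alpha>, \<alpha>', \<beta>) \<in> rrs_autotopism_group n L. real (psi n \<alpha> \<beta>))"
proof -
  let ?G = "rrs_autotopism_monoid n L" and ?E = "{\<tau>. \<tau> permutes {1..n}}"
  interpret group_action ?G ?E "translate n"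
    by (rule group_action_translate)
  have "rrs_autotopism_group n L \<subseteq> ?E \<times> ?E \<times> ?E"
    by (auto simp: mem_rrs_autotopism_group)
  then have fin: "finite (rrs_autotopism_group n L)"
    by (rule finite_subset) (simp add: finite_permutations)
  have "(id, id, id) \<in> rrs_autotopism_group n L"
    unfolding mem_rrs_autotopism_group using permutes_id apply_isotopism_id by blast
  then have pos: "card (rrs_autotopism_group n L) > 0"
    using fin by (auto simp: card_gt_0_iff)
  \<comment> \<open>Burnside's lemma in product form stays in the natural numbers; the division
    takes place over the reals at the end.\<close>
  have "card (orbits ?G ?E (translate n)) * order ?G =
      (\<Sum>g\<in>carrier ?G. card (invariants ?E (translate n) g))"
    using fin by (intro burnside) (simp_all add: rrs_autotopism_monoid_def finite_permutations)
  also have "\<dots> = (\<Sum>(\<alpha>, \<alpha>', \<beta>) \<in> rrs_autotopism_group n L. psi n \<alpha> \<beta>)"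
    using card_invariants_translate by (intro sum.cong) (auto simp: rrs_autotopism_monoid_def)
  finally have "card (orbits ?G ?E (translate n)) * card (rrs_autotopism_group n L) =
      (\<Sum>(\<alpha>, \<alpha>', \<beta>) \<in> rrs_autotopism_group n L. psi n \<alpha> \<beta>)"
    by (simp add: order_def rrs_autotopism_monoid_def)
  then have "real (card (orbits ?G ?E (translate n))) * real (card (rrs_autotopism_group n L)) =
      (\<Sum>(\<alpha>, \<alpha>', \<beta>) \<in> rrs_autotopism_group n L. real (psi n \<alpha> \<beta>))"
    by (simp add: case_prod_beta flip: of_nat_mult of_nat_sum)
  then show ?thesis
    using pos unfolding card_isomorphism_classes[OF assms] by (simp add: field_simps)
qed

end
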